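(* Let $p\ge0$. The graph $C_5+p$, obtained from the $5$-cycle $C_5$ by adding $p$ universal vertices, is a projective core.
   Context: Graphs are finite, simple, undirected, loopless. Formally $C_5+p$ has vertex set $V_{C_5}\uplus V_{K_p}$ and edge set $E_{C_5}\cup E_{K_p}$ together with all edges between $V_{C_5}$ and $V_{K_p}$ (the added $p$ vertices are pairwise adjacent and adjacent to all vertices of $C_5$). $H$ is a core if every homomorphism $H\to H$ is bijective. A polymorphism $f:V_H^m\to V_H$ is a homomorphism $H^m\to H$ (direct product); it is idempotent if $f(x,\dots,x)=x$. $H$ is projective if every idempotent polymorphism is a projection. *)

theory Defs
  imports "Graph_Theory.Graph_Theory" "HOL-Library.FuncSet"
begin

text \<open>
  A finite simple undirected loopless graph is a \<^term>\<open>pair_graph\<close>: an undirected edge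
  \<open>uv\<close> is represented by the two arcs \<open>(u, v)\<close> and \<open>(v, u)\<close>.
\<close>

definition graph_hom ::
    "'a pair_pre_digraph \<Rightarrow> 'b pair_pre_digraph \<Rightarrow> ('a \<Rightarrow> 'b) \<Rightarrow> bool" where
  "graph_hom G H f \<longleftrightarrow>
     f \<in> pverts G \<rightarrow> pverts H \<and> (\<forall>(u, v) \<in> parcs G. (f u, f v) \<in> parcs H)"

definition graph_core :: "'a pair_pre_digraph \<Rightarrow> bool" where
  "graph_core H \<longleftrightarrow> (\<forall>f. graph_hom H H f \<longrightarrow> bij_betw f (pverts H) (pverts H))"

text \<open>Direct (categorical) power; an \<open>m\<close>-tuple is an extensional function on \<open>{..<m}\<close>.\<close>

definition graph_power :: "'a pair_pre_digraph \<Rightarrow> nat \<Rightarrow> (nat \<Rightarrow> 'a) pair_pre_digraph" where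
  "graph_power H m =
     \<lparr> pverts = {..<m} \<rightarrow>\<^sub>E pverts H,
       parcs = {(x, y). x \<in> {..<m} \<rightarrow>\<^sub>E pverts H \<and> y \<in> {..<m} \<rightarrow>\<^sub>E pverts H \<and>
                        (\<forall>i<m. (x i, y i) \<in> parcs H)} \<rparr>"

definition polymorphism :: "'a pair_pre_digraph \<Rightarrow> nat \<Rightarrow> ((nat \<Rightarrow> 'a) \<Rightarrow> 'a) \<Rightarrow> bool" where
  "polymorphism H m f \<longleftrightarrow> graph_hom (graph_power H m) H f"

definition idempotent_op :: "'a pair_pre_digraph \<Rightarrow> nat \<Rightarrow> ((nat \<Rightarrow> 'a) \<Rightarrow> 'a) \<Rightarrow> bool" where
  "idempotent_op H m f \<longleftrightarrow> (\<forall>x \<in> pverts H. f (\<lambda>i\<in>{..<m}. x) = x)"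

definition projection_op :: "'a pair_pre_digraph \<Rightarrow> nat \<Rightarrow> ((nat \<Rightarrow> 'a) \<Rightarrow> 'a) \<Rightarrow> bool" where
  "projection_op H m f \<longleftrightarrow> (\<exists>i<m. \<forall>x \<in> {..<m} \<rightarrow>\<^sub>E pverts H. f x = x i)"

definition projective_graph :: "'a pair_pre_digraph \<Rightarrow> bool" where
  "projective_graph H \<longleftrightarrow>
     (\<forall>m\<ge>1. \<forall>f. polymorphism H m f \<and> idempotent_op H m f \<longrightarrow> projection_op H m f)"

definition C5 :: "nat pair_pre_digraph" where
  "C5 = \<lparr> pverts = {..<5},
          parcs = {(i, j). i < 5 \<and> j < 5 \<and> (j = (i + 1) mod 5 \<or> i = (j + 1) mod 5)} \<rparr>"

definition complete_graph :: "nat \<Rightarrow> nat pair_pre_digraph" where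
  "complete_graph n = \<lparr> pverts = {..<n}, parcs = {(i, j). i < n \<and> j < n \<and> i \<noteq> j} \<rparr>"

definition graph_join ::
    "'a pair_pre_digraph \<Rightarrow> 'b pair_pre_digraph \<Rightarrow> ('a + 'b) pair_pre_digraph" where
  "graph_join G H =
     \<lparr> pverts = pverts G <+> pverts H,
       parcs = map_prod Inl Inl ` parcs G \<union> map_prod Inr Inr ` parcs H \<union>
               (Inl ` pverts G) \<times> (Inr ` pverts H) \<union> (Inr ` pverts H) \<times> (Inl ` pverts G) \<rparr>"

definition C5_plus :: "nat \<Rightarrow> (nat + nat) pair_pre_digraph" where
  "C5_plus p = graph_join C5 (complete_graph p)"

lemma complete_graph_K: "K\<^bsub>n\<^esub> (with_proj (complete_graph n))"
  by (auto simp: complete_digraph_pair_def complete_graph_def)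

lemma pair_graphI:
  assumes "finite (pverts G)" "parcs G \<subseteq> pverts G \<times> pverts G" "sym (parcs G)" "irrefl (parcs G)"
  shows "pair_graph G"
proof -
  have "finite (parcs G)"
    using assms(1,2) by (meson finite_SigmaI finite_subset)
  then show ?thesis
    using assms by unfold_locales (auto simp: symmetric_def irrefl_def)
qed

lemma pair_graph_C5: "pair_graph C5"
  by (rule pair_graphI) (auto simp: C5_def sym_def irrefl_def mod_Suc)

lemma pair_graph_complete_graph: "pair_graph (complete_graph n)"
  by (rule pair_graphI) (auto simp: complete_graph_def sym_def irrefl_def)

lemma pair_graph_join:
  assumes "pair_graph G" "pair_graph H"
  shows "pair_graph (graph_join G H)"
proof -
  interpret G: pair_graph G by fact
  interpret H: pair_graph H by fact
  show ?thesis
  proof (rule pair_graphI)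
    show "finite (pverts (graph_join G H))"
      by (simp add: graph_join_def)
    show "parcs (graph_join G H) \<subseteq> pverts (graph_join G H) \<times> pverts (graph_join G H)"
      by (auto simp: graph_join_def
          dest: G.arc_fst_in_verts G.arc_snd_in_verts H.arc_fst_in_verts H.arc_snd_in_verts)
    show "sym (parcs (graph_join G H))"
      using G.pair_sym_arcs H.pair_sym_arcs
      by (auto simp: graph_join_def symmetric_def sym_def)
    show "irrefl (parcs (graph_join G H))"
      by (auto simp: graph_join_def irrefl_def dest: G.pair_no_loops H.pair_no_loops)
  qed
qed

lemma pair_graph_C5_plus: "pair_graph (C5_plus p)"
  unfolding C5_plus_def
  by (intro pair_graph_join pair_graph_C5 pair_graph_complete_graph)

end

theory Submission
  imports Defs
begin

text \<open>
  The graph is a core because two identified vertices \<open>i\<close>, \<open>i + 2\<close> of the cycle would make the image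
  of \<open>{i, i + 3, i + 4}\<close> and of the universal vertices a clique of size \<open>p + 3\<close>, which is too large.

  An idempotent polymorphism maps tuples over the cycle into the cycle, the common neighbourhood of
  the universal vertices. Two vertices of a 5-cycle are distinct if and only if they are joined by a walk
  of length 3, so on the cycle the polymorphism preserves disequality. Hence the sets of
  coordinates that impose their value form an ultrafilter, and the polymorphism is a projection
  there. The adjacencies between the cycle and the universal vertices extend this to all tuples.
\<close>

section \<open>Operations preserving disequality\<close>

text \<open>Disequality is the edge relation of the complete graph on \<open>S\<close>, so this is
  projectivity of complete graphs with at least three vertices. The ultrafilter of winning sets is
  principal because \<open>I\<close> is finite.\<close>

lemma projection_if_preserves_noteq:
  fixes f :: "('i \<Rightarrow> 'a) \<Rightarrow> 'a"
  assumes "finite I"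
    and S: "a \<in> S" "b \<in> S" "c \<in> S" and dist: "a \<noteq> b" "a \<noteq> c" "b \<noteq> c"
    and closed: "\<And>x. x \<in> I \<rightarrow>\<^sub>E S \<Longrightarrow> f x \<in> S"
    and idem: "\<And>s. s \<in> S \<Longrightarrow> f (\<lambda>i\<in>I. s) = s"
    and noteq: "\<And>x y. x \<in> I \<rightarrow>\<^sub>E S \<Longrightarrow> y \<in> I \<rightarrow>\<^sub>E S \<Longrightarrow> (\<And>i. i \<in> I \<Longrightarrow> x i \<noteq> y i) \<Longrightarrow> f x \<noteq> f y"
  shows "\<exists>i\<in>I. \<forall>x \<in> I \<rightarrow>\<^sub>E S. f x = x i"
proof -
  define t where "t A u v = (\<lambda>i\<in>I. if i \<in> A then u else v)" for A and u v :: 'a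
  have t_in: "t A u v \<in> I \<rightarrow>\<^sub>E S" if "u \<in> S" "v \<in> S" for A u v
    using that by (auto simp: t_def)
  \<comment> \<open>Otherwise \<open>x\<close> differs everywhere from the constant tuple of
    \<open>f x\<close>, which by idempotence has the same image.\<close>
  have cons: "\<exists>i\<in>I. f x = x i" if x: "x \<in> I \<rightarrow>\<^sub>E S" for x
  proof (rule ccontr)
    assume "\<not> ?thesis"
    then have "f x \<noteq> f (\<lambda>i\<in>I. f x)"
      using x closed[OF x] by (intro noteq) auto
    then show False using idem closed[OF x] by simp
  qed
  have two: "f (t A u v) = u \<or> f (t A u v) = v" if "u \<in> S" "v \<in> S" for A u v
    using cons[OF t_in[OF that, of A]] by (auto simp: t_def split: if_splits)
  \<comment> \<open>The two tuples differ everywhere, so the value \<open>v\<close> of the first is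
    excluded for the second.\<close>
  have step: "f (t A v w) = w"
    if "f (t A u v) = v" "u \<noteq> v" "v \<noteq> w" "u \<in> S" "v \<in> S" "w \<in> S" for A u v w
  proof -
    have "f (t A u v) \<noteq> f (t A v w)"
      using that by (intro noteq t_in) (auto simp: t_def)
    then show ?thesis using two[of v w A] that by auto
  qed
  \<comment> \<open>The pair \<open>(u, v)\<close> moves to \<open>(v, u')\<close> and then to
    \<open>(u', v')\<close>; if \<open>v = u'\<close>, a single move suffices.\<close>
  have transfer: "f (t A u' v') = v'"
    if "f (t A u v) = v" "u \<noteq> v" "u' \<noteq> v'" "u \<in> S" "v \<in> S" "u' \<in> S" "v' \<in> S" for A u v u' v'
    using step[of A u v v'] step[of A u v u'] step[of A v u' v'] that by (cases "v = u'") auto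
  define win where "win A \<longleftrightarrow> f (t A a b) = a" for A
  have win: "f (t A u v) = u" if "win A" "u \<noteq> v" "u \<in> S" "v \<in> S" for A u v
    using transfer[of A u v a b] two[of u v A] that S dist by (auto simp: win_def)
  have compl: "win (I - A)" if "\<not> win A" for A
  proof -
    have "f (t A b a) = a"
      using transfer[of A a b b a] two[of a b A] that S dist by (auto simp: win_def)
    moreover have "t A b a = t (I - A) a b" by (auto simp: t_def)
    ultimately show ?thesis by (simp add: win_def)
  qed
  have loses: "f x \<noteq> s"
    if A: "win A" and x: "x \<in> I \<rightarrow>\<^sub>E S" and "s \<in> S" "r \<in> S" "s \<noteq> r"
      and "\<And>i. i \<in> I \<Longrightarrow> i \<in> A \<Longrightarrow> x i \<noteq> s" "\<And>i. i \<in> I \<Longrightarrow> i \<notin> A \<Longrightarrow> x i \<noteq> r" for A x s r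
  proof -
    have "f x \<noteq> f (t A s r)"
      using that by (intro noteq t_in) (auto simp: t_def)
    then show ?thesis using win that by simp
  qed
  have inter: "win (A \<inter> B)" if A: "win A" and B: "win B" for A B
  proof (rule ccontr)
    assume "\<not> win (A \<inter> B)"
    then have C: "win (I - A \<inter> B)" by (rule compl)
    \<comment> \<open>The values mark \<open>I - A\<close>, \<open>A - B\<close> and
      \<open>A \<inter> B\<close>; the winning sets \<open>A\<close>, \<open>B\<close> and
      \<open>I - A \<inter> B\<close> exclude \<open>a\<close>, \<open>b\<close> and
      \<open>c\<close> in turn.\<close>
    define x where "x = (\<lambda>i\<in>I. if i \<notin> A then a else if i \<notin> B then b else c)"
    have x: "x \<in> I \<rightarrow>\<^sub>E S" using S by (auto simp: x_def)
    have "f x \<noteq> a" using S dist by (intro loses[OF A x, of a b]) (auto simp: x_def)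
    moreover have "f x \<noteq> b"
      using S dist by (intro loses[OF B x, of b c]) (auto simp: x_def)
    moreover have "f x \<noteq> c"
      using S dist by (intro loses[OF C x, of c a]) (auto simp: x_def)
    ultimately show False using cons[OF x] by (auto simp: x_def split: if_splits)
  qed
  have not_empty: "\<not> win {}"
    using idem[of b] S dist by (simp add: win_def t_def)
  have full: "win I" using compl[of "{}"] not_empty by simp
  \<comment> \<open>Coordinates are discarded one by one; for \<open>J = I\<close> the first
    alternative would let the empty set win.\<close>
  have "win (I - J) \<or> (\<exists>i\<in>J. win {i})" if "finite J" for J
    using that
  proof (induction J)
    case empty
    then show ?case using full by simp
  next
    case (insert j J)
    have "(I - J) \<inter> (I - {j}) = I - insert j J" by auto
    then show ?case using insert.IH inter[of "I - J" "I - {j}"] compl[of "{j}"] by auto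
  qed
  from this[OF \<open>finite I\<close>] obtain i where i: "i \<in> I" "win {i}"
    using not_empty by auto
  have up: "win A" if "i \<in> A" for A
  proof (rule ccontr)
    assume "\<not> win A"
    then have "win ((I - A) \<inter> {i})" using compl inter i by blast
    moreover have "(I - A) \<inter> {i} = {}" using that by auto
    ultimately show False using not_empty by simp
  qed
  have "f x = x i" if x: "x \<in> I \<rightarrow>\<^sub>E S" for x
  proof (rule ccontr)
    assume ne: "f x \<noteq> x i"
    obtain r where r: "r \<in> S" "r \<noteq> f x" using S dist by metis
    \<comment> \<open>The set of disagreement with \<open>f x\<close> contains \<open>i\<close>,
      hence wins, and so excludes the value \<open>f x\<close>.\<close>
    have "win {j. x j \<noteq> f x}" using ne by (intro up) simp
    from loses[OF this x closed[OF x] r(1) r(2)[symmetric]] r(2) show False by auto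
  qed
  then show ?thesis using i(1) by auto
qed

section \<open>Adjacency in the 5-cycle and in \<open>C5_plus\<close>\<close>

lemma pverts_C5_plus:
  "pverts (C5_plus p) = Inl ` {..<5} \<union> Inr ` {..<p}"
  by (auto simp: C5_plus_def graph_join_def C5_def complete_graph_def)

lemma parcs_C5_plus [simp]:
  "(Inl i, Inl j) \<in> parcs (C5_plus p) \<longleftrightarrow> (i, j) \<in> parcs C5"
  "(Inr u, Inr v) \<in> parcs (C5_plus p) \<longleftrightarrow> u < p \<and> v < p \<and> u \<noteq> v"
  "(Inl i, Inr u) \<in> parcs (C5_plus p) \<longleftrightarrow> i < 5 \<and> u < p"
  "(Inr u, Inl i) \<in> parcs (C5_plus p) \<longleftrightarrow> i < 5 \<and> u < p"
  unfolding C5_plus_def graph_join_def by (auto simp: C5_def complete_graph_def image_iff)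

lemma parcs_C5_iff:
  "(i, j) \<in> parcs C5 \<longleftrightarrow>
     i < 5 \<and> j < 5 \<and> (j = i + 1 \<or> i = j + 1 \<or> i = 0 \<and> j = 4 \<or> i = 4 \<and> j = 0)"
  by (auto simp: C5_def mod_Suc)

lemma C5_no_triangle:
  "(i, j) \<in> parcs C5 \<Longrightarrow> (j, k) \<in> parcs C5 \<Longrightarrow> (k, i) \<notin> parcs C5"
  unfolding parcs_C5_iff by (elim conjE disjE) auto

text \<open>An edge is walked back and forth; vertices at distance two are joined by the long way
  round.\<close>

lemma C5_walk3:
  assumes "i < 5" "j < 5" "i \<noteq> j"
  shows "\<exists>k l. (i, k) \<in> parcs C5 \<and> (k, l) \<in> parcs C5 \<and> (l, j) \<in> parcs C5"
proof -
  have walk: "\<exists>k l. (i, k) \<in> parcs C5 \<and> (k, l) \<in> parcs C5 \<and> (l, j) \<in> parcs C5"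
    if "i < j" "j < 5" for i j
  proof -
    have d: "j = i + 1 \<or> j = i + 2 \<or> j = i + 3 \<or> j = i + 4" using that by linarith
    have i: "i = 0 \<or> i = 1 \<or> i = 2 \<or> i = 3" using that by linarith
    consider "j = i + 1 \<or> i = 0 \<and> j = 4" | "i = 0" "j = 2" | "i = 1" "j = 3" | "i = 2" "j = 4"
      | "i = 0" "j = 3" | "i = 1" "j = 4"
      using d i \<open>j < 5\<close> by (elim disjE) auto
    then show ?thesis
    proof cases
      case 1
      with that show ?thesis by (intro exI[of _ j] exI[of _ i]) (auto simp: parcs_C5_iff)
    next
      case 2
      then show ?thesis by (intro exI[of _ 4] exI[of _ 3]) (simp add: parcs_C5_iff)
    next
      case 3
      then show ?thesis by (intro exI[of _ 0] exI[of _ 4]) (simp add: parcs_C5_iff)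
    next
      case 4
      then show ?thesis by (intro exI[of _ 1] exI[of _ 0]) (simp add: parcs_C5_iff)
    next
      case 5
      then show ?thesis by (intro exI[of _ 1] exI[of _ 2]) (simp add: parcs_C5_iff)
    next
      case 6
      then show ?thesis by (intro exI[of _ 2] exI[of _ 3]) (simp add: parcs_C5_iff)
    qed
  qed
  have sym: "(u, v) \<in> parcs C5 \<Longrightarrow> (v, u) \<in> parcs C5" for u v
    unfolding parcs_C5_iff by blast
  show ?thesis
    using walk[of i j] walk[of j i] assms sym by (meson nat_neq_iff)
qed

text \<open>The cyclic successor and predecessor of \<open>i\<close> have no common neighbour
  besides \<open>i\<close>, as there is no 4-cycle.\<close>

lemma C5_neighbourhood_inject:
  assumes "i < 5" "j < 5" "\<And>k. (i, k) \<in> parcs C5 \<Longrightarrow> (j, k) \<in> parcs C5"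
  shows "i = j"
proof -
  have "i = 0 \<or> i = 1 \<or> i = 2 \<or> i = 3 \<or> i = 4" using assms(1) by linarith
  then show ?thesis
    using assms(2) assms(3)[of "if i = 4 then 0 else i + 1"]
      assms(3)[of "if i = 0 then 4 else i - 1"]
    by (elim disjE) (auto simp: parcs_C5_iff)
qed

lemma C5_plus_loopless: "(z, z) \<notin> parcs (C5_plus p)"
proof -
  interpret pair_graph "C5_plus p" by (rule pair_graph_C5_plus)
  show ?thesis using pair_no_loops[of "(z, z)"] by auto
qed

lemma C5_plus_cycle_neighbour:
  assumes "z \<in> pverts (C5_plus p)"
  shows "\<exists>k<5. (z, Inl k) \<in> parcs (C5_plus p)"
proof -
  have "(i, if i = 4 then 0 else i + 1) \<in> parcs C5" if "i < 5" for i
    using that unfolding parcs_C5_iff by presburger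
  moreover have "(if i = 4 then 0 else i + 1) < (5::nat)" if "i < 5" for i
    using that by presburger
  ultimately have "\<exists>k<5. (i, k) \<in> parcs C5" if "i < 5" for i using that by blast
  then show ?thesis
    using assms by (auto simp: pverts_C5_plus intro: exI[of _ 0])
qed

text \<open>A universal vertex fails the second assumption at itself.\<close>

lemma C5_plus_in_cycle:
  assumes "z \<in> pverts (C5_plus p)" "\<And>u. u < p \<Longrightarrow> (z, Inr u) \<in> parcs (C5_plus p)"
  shows "z \<in> Inl ` {..<5}"
proof (cases z)
  case (Inr u)
  then show ?thesis using assms(1) assms(2)[of u] by (auto simp: pverts_C5_plus)
qed (use assms(1) in \<open>auto simp: pverts_C5_plus\<close>)

section \<open>Cliques and the core property\<close>

text \<open>The triangle-free cycle contributes at most two vertices to a clique.\<close>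

lemma C5_plus_clique_card:
  assumes Q: "Q \<subseteq> pverts (C5_plus p)"
    and clique: "\<And>x y. x \<in> Q \<Longrightarrow> y \<in> Q \<Longrightarrow> x \<noteq> y \<Longrightarrow> (x, y) \<in> parcs (C5_plus p)"
  shows "card Q \<le> p + 2"
proof -
  define T where "T = {i. Inl i \<in> Q}"
  have T: "T \<subseteq> {..<5}" using Q by (auto simp: T_def pverts_C5_plus)
  have "card T \<le> 2"
  proof (rule ccontr)
    assume "\<not> ?thesis"
    then obtain R where "R \<subseteq> T" "card R = 3"
      using obtain_subset_with_card_n[of 3 T] by auto
    then obtain i j k where "{i, j, k} \<subseteq> T" "i \<noteq> j" "j \<noteq> k" "k \<noteq> i"
      by (auto simp: card_3_iff)
    then show False
      using clique[of "Inl i" "Inl j"] clique[of "Inl j" "Inl k"] clique[of "Inl k" "Inl i"]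
        C5_no_triangle[of i j k] by (auto simp: T_def)
  qed
  have "Q \<subseteq> Inl ` T \<union> Inr ` {..<p}" using Q by (auto simp: T_def pverts_C5_plus)
  then have "card Q \<le> card (Inl ` T \<union> Inr ` {..<p} :: (nat + nat) set)"
    using finite_subset[OF T] by (intro card_mono) auto
  also have "\<dots> \<le> card (Inl ` T :: (nat + nat) set) + card (Inr ` {..<p} :: (nat + nat) set)"
    by (rule card_Un_le)
  also have "\<dots> \<le> p + 2" using \<open>card T \<le> 2\<close> by (simp add: card_image)
  finally show ?thesis .
qed

lemma graph_core_C5_plus: "graph_core (C5_plus p)"
  unfolding graph_core_def
proof (intro allI impI)
  fix f assume hom: "graph_hom (C5_plus p) (C5_plus p) f"
  let ?E = "parcs (C5_plus p)"
  from hom have V: "f ` pverts (C5_plus p) \<subseteq> pverts (C5_plus p)"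
    by (auto simp: graph_hom_def)
  from hom have E: "(f x, f y) \<in> ?E" if "(x, y) \<in> ?E" for x y
    using that by (auto simp: graph_hom_def)
  interpret pair_graph "C5_plus p" by (rule pair_graph_C5_plus)
  have "inj_on f (pverts (C5_plus p))"
  proof (rule inj_onI, rule ccontr)
    fix x y assume xy: "x \<in> pverts (C5_plus p)" "y \<in> pverts (C5_plus p)" "f x = f y" "x \<noteq> y"
    then have "(x, y) \<notin> ?E" "(y, x) \<notin> ?E"
      using E[of x y] E[of y x] C5_plus_loopless by auto
    \<comment> \<open>Identified vertices are nonadjacent, so neither is universal.\<close>
    then obtain i j where ij: "x = Inl i" "y = Inl j" "i < 5" "j < 5" "i \<noteq> j"
      using xy by (auto simp: pverts_C5_plus)
    then obtain k l where kl: "(i, k) \<in> parcs C5" "(k, l) \<in> parcs C5" "(l, j) \<in> parcs C5"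
      using C5_walk3 by blast
    define P :: "(nat + nat) set" where "P = {Inl i, Inl k, Inl l} \<union> Inr ` {..<p}"
    have less: "k < 5" "l < 5" using kl by (auto simp: C5_def)
    have P: "P \<subseteq> pverts (C5_plus p)"
      using ij less by (auto simp: P_def pverts_C5_plus)
    have sym: "(v, u) \<in> ?E" if "(u, v) \<in> ?E" for u v
      using that pair_sym_arcs by (auto simp: symmetric_def sym_def)
    \<comment> \<open>The only edge missing in \<open>P\<close> appears in the image:
      \<open>l\<close> is adjacent to \<open>j\<close>, which is identified with
      \<open>i\<close>.\<close>
    have il: "(f (Inl i), f (Inl l)) \<in> ?E"
      using E[of "Inl l" "Inl j"] kl xy(3) ij sym by auto
    have clique: "(f u, f v) \<in> ?E" if "u \<in> P" "v \<in> P" "u \<noteq> v" for u v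
    proof -
      have "(u, v) \<in> ?E \<or> (u, v) \<in> {(Inl i, Inl l), (Inl l, Inl i)}"
        using that kl sym[of "Inl i" "Inl k"] sym[of "Inl k" "Inl l"] ij(3) less
        unfolding P_def by auto
      then show ?thesis using E il sym by blast
    qed
    have "inj_on f P"
      using clique C5_plus_loopless by (fastforce simp: inj_on_def)
    moreover have "i \<noteq> k" "k \<noteq> l" "i \<noteq> l"
      using kl \<open>(x, y) \<notin> _\<close> \<open>(y, x) \<notin> _\<close> ij by (auto simp: parcs_C5_iff)
    then have "card P = p + 3"
      unfolding P_def by (subst card_Un_disjoint) (auto simp: card_image)
    ultimately have "card (f ` P) = p + 3" by (simp add: card_image)
    moreover have "card (f ` P) \<le> p + 2"
      using V P clique by (intro C5_plus_clique_card) auto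
    ultimately show False by simp
  qed
  then show "bij_betw f (pverts (C5_plus p)) (pverts (C5_plus p))"
    using V endo_inj_surj[of "pverts (C5_plus p)" f] by (simp add: bij_betw_def)
qed

section \<open>Projectivity\<close>

text \<open>Beyond the cycle, \<open>f x\<close> is recovered from its neighbours: they include all
  neighbours of \<open>x i\<close>, and no vertex has its neighbourhood contained in that of
  another.\<close>

lemma projective_C5_plus: "projective_graph (C5_plus p)"
  unfolding projective_graph_def
proof (intro allI impI, elim conjE)
  fix m f assume poly: "polymorphism (C5_plus p) m f" and idem: "idempotent_op (C5_plus p) m f"
  let ?V = "pverts (C5_plus p)" and ?E = "parcs (C5_plus p)" and ?C = "Inl ` {..<5} :: (nat + nat) set"
  interpret pair_graph "C5_plus p" by (rule pair_graph_C5_plus)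
  have head: "s \<in> ?V" if "(z, s) \<in> ?E" for z s
    using arc_snd_in_verts[OF that] by simp
  have V: "f x \<in> ?V" if "x \<in> {..<m} \<rightarrow>\<^sub>E ?V" for x
    using poly that by (auto simp: polymorphism_def graph_hom_def graph_power_def)
  have E: "(f x, f y) \<in> ?E"
    if "x \<in> {..<m} \<rightarrow>\<^sub>E ?V" "y \<in> {..<m} \<rightarrow>\<^sub>E ?V" "\<And>i. i < m \<Longrightarrow> (x i, y i) \<in> ?E" for x y
    using poly that by (auto simp: polymorphism_def graph_hom_def graph_power_def)
  have const: "f (\<lambda>i\<in>{..<m}. s) = s" if "s \<in> ?V" for s
    using idem that by (auto simp: idempotent_op_def)
  have E_const: "(f x, s) \<in> ?E"
    if "x \<in> {..<m} \<rightarrow>\<^sub>E ?V" "s \<in> ?V" "\<And>i. i < m \<Longrightarrow> (x i, s) \<in> ?E" for x s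
    using E[of x "\<lambda>i\<in>{..<m}. s"] const[of s] that by auto
  have CV: "x \<in> {..<m} \<rightarrow>\<^sub>E ?V" if "x \<in> {..<m} \<rightarrow>\<^sub>E ?C" for x
    using that by (auto simp: pverts_C5_plus PiE_iff)
  have C: "f x \<in> ?C" if x: "x \<in> {..<m} \<rightarrow>\<^sub>E ?C" for x
  proof (rule C5_plus_in_cycle)
    show "f x \<in> ?V" using V CV x by blast
    show "(f x, Inr u) \<in> ?E" if "u < p" for u
      using x that by (intro E_const CV) (force simp: pverts_C5_plus PiE_iff)+
  qed
  have walk3: "\<exists>k l. k \<in> ?C \<and> l \<in> ?C \<and> (a, k) \<in> ?E \<and> (k, l) \<in> ?E \<and> (l, b) \<in> ?E"
    if ab: "a \<in> ?C" "b \<in> ?C" "a \<noteq> b" for a b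
  proof -
    from ab obtain i j where ij: "a = Inl i" "b = Inl j" "i < 5" "j < 5" "i \<noteq> j" by auto
    then obtain k l where kl: "(i, k) \<in> parcs C5" "(k, l) \<in> parcs C5" "(l, j) \<in> parcs C5"
      using C5_walk3 by blast
    then have "k < 5" "l < 5" by (auto simp: C5_def)
    then show ?thesis using ij kl by (intro exI[of _ "Inl k"] exI[of _ "Inl l"]) auto
  qed
  have noteq: "f x \<noteq> f y"
    if x: "x \<in> {..<m} \<rightarrow>\<^sub>E ?C" and y: "y \<in> {..<m} \<rightarrow>\<^sub>E ?C" and ne: "\<And>i. i \<in> {..<m} \<Longrightarrow> x i \<noteq> y i"
    for x y
  proof
    assume eq: "f x = f y"
    \<comment> \<open>Walks of length 3 chosen at each coordinate form a walk of tuples; if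
      \<open>f x = f y\<close>, its image is a triangle in the cycle.\<close>
    have "\<exists>k l. k \<in> ?C \<and> l \<in> ?C \<and> (x i, k) \<in> ?E \<and> (k, l) \<in> ?E \<and> (l, y i) \<in> ?E" if "i < m" for i
      using that by (intro walk3 PiE_mem[OF x] PiE_mem[OF y] ne) simp_all
    then obtain k l where kl: "\<And>i. i < m \<Longrightarrow>
        k i \<in> ?C \<and> l i \<in> ?C \<and> (x i, k i) \<in> ?E \<and> (k i, l i) \<in> ?E \<and> (l i, y i) \<in> ?E"
      by metis
    define k' where "k' = restrict k {..<m}"
    define l' where "l' = restrict l {..<m}"
    have k': "k' \<in> {..<m} \<rightarrow>\<^sub>E ?C" and l': "l' \<in> {..<m} \<rightarrow>\<^sub>E ?C"
      using kl by (auto simp: k'_def l'_def)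
    have "(f x, f k') \<in> ?E" using kl by (intro E CV x k') (simp add: k'_def)
    moreover have "(f k', f l') \<in> ?E" using kl by (intro E CV k' l') (simp add: k'_def l'_def)
    moreover have "(f l', f y) \<in> ?E" using kl by (intro E CV l' y) (simp add: l'_def)
    ultimately show False
      using C[OF x] C[OF k'] C[OF l'] eq by (auto dest: C5_no_triangle)
  qed
  have "\<exists>i\<in>{..<m}. \<forall>x \<in> {..<m} \<rightarrow>\<^sub>E ?C. f x = x i"
  proof (rule projection_if_preserves_noteq)
    show "Inl 0 \<in> ?C" "Inl 1 \<in> ?C" "Inl 2 \<in> ?C" by auto
    show "f (\<lambda>i\<in>{..<m}. s) = s" if "s \<in> ?C" for s
      using that by (intro const) (auto simp: pverts_C5_plus)
  qed (use C noteq in auto)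
  then obtain i where i: "i < m" and proj: "\<And>x. x \<in> {..<m} \<rightarrow>\<^sub>E ?C \<Longrightarrow> f x = x i" by auto
  \<comment> \<open>Away from coordinate \<open>i\<close> a neighbour of \<open>x\<close> can be chosen on the cycle, so that it is
    adjacent to every universal vertex other than its \<open>i\<close>-th entry.\<close>
  have nb: "\<exists>y \<in> {..<m} \<rightarrow>\<^sub>E ?V. y i = s \<and> (\<forall>j<m. (x j, y j) \<in> ?E) \<and> (\<forall>j<m. j \<noteq> i \<longrightarrow> y j \<in> ?C)"
    if x: "x \<in> {..<m} \<rightarrow>\<^sub>E ?V" and s: "(x i, s) \<in> ?E" for x s
  proof -
    have "\<exists>k<5. (x j, Inl k) \<in> ?E" if "j < m" for j
      using that by (intro C5_plus_cycle_neighbour PiE_mem[OF x]) simp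
    then obtain k where k: "\<And>j. j < m \<Longrightarrow> k j < 5 \<and> (x j, Inl (k j)) \<in> ?E"
      by metis
    have "s \<in> ?V" using s by (rule head)
    then show ?thesis
      using i k s by (intro bexI[of _ "\<lambda>j\<in>{..<m}. if j = i then s else Inl (k j)"])
        (auto simp: pverts_C5_plus)
  qed
  \<comment> \<open>With \<open>s\<close> on the cycle, the neighbour \<open>y\<close> of
    \<open>x\<close> lies wholly on the cycle, so \<open>f y = y i = s\<close>.\<close>
  have nb_cycle: "(f x, s) \<in> ?E" if x: "x \<in> {..<m} \<rightarrow>\<^sub>E ?V" and s: "(x i, s) \<in> ?E" "s \<in> ?C" for x s
  proof -
    obtain y where y: "y \<in> {..<m} \<rightarrow>\<^sub>E ?V" "y i = s" "\<forall>j<m. (x j, y j) \<in> ?E"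
      "\<forall>j<m. j \<noteq> i \<longrightarrow> y j \<in> ?C"
      using nb[OF x s(1)] by blast
    have "y \<in> {..<m} \<rightarrow>\<^sub>E ?C" using y s(2) by (auto simp: PiE_iff)
    then show ?thesis using proj y E[OF x y(1)] by auto
  qed
  \<comment> \<open>Here \<open>f x\<close> is adjacent to the whole cycle; lying on it would create
    a loop.\<close>
  have above: "f x \<in> Inr ` {..<p}" if x: "x \<in> {..<m} \<rightarrow>\<^sub>E ?V" and s: "x i = Inr u" for x u
  proof -
    have "u < p" using PiE_mem[OF x, of i] i s by (auto simp: pverts_C5_plus)
    then have "(f x, Inl k) \<in> ?E" if "k < 5" for k
      using nb_cycle[OF x, of "Inl k"] that s by auto
    then have "f x \<notin> ?C" using C5_plus_loopless[of "f x" p] by (auto simp del: parcs_C5_plus)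
    then show ?thesis using V[OF x] by (auto simp: pverts_C5_plus)
  qed
  have nb_all: "(f x, s) \<in> ?E" if x: "x \<in> {..<m} \<rightarrow>\<^sub>E ?V" and s: "(x i, s) \<in> ?E" for x s
  proof (cases s)
    case (Inl k)
    then have "s \<in> ?C" using head[OF s] by (auto simp: pverts_C5_plus)
    then show ?thesis using nb_cycle x s by blast
  next
    case (Inr u)
    obtain y where y: "y \<in> {..<m} \<rightarrow>\<^sub>E ?V" "y i = s" "\<forall>j<m. (x j, y j) \<in> ?E"
      "\<forall>j<m. j \<noteq> i \<longrightarrow> y j \<in> ?C"
      using nb[OF x s] by blast
    have u: "u < p" using head[OF s] Inr by (auto simp: pverts_C5_plus)
    obtain v where v: "v < p" "f y = Inr v" using above[OF y(1)] y(2) Inr by auto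
    have "v = u"
    \<comment> \<open>If \<open>v\<close> differs from \<open>u\<close>, every entry of
      \<open>y\<close> is adjacent to \<open>Inr v\<close>, hence so is \<open>f y\<close>, which is
      \<open>Inr v\<close> itself.\<close>
    proof (rule ccontr)
      assume "v \<noteq> u"
      have "(y j, Inr v) \<in> ?E" if "j < m" for j
        using y that u v \<open>v \<noteq> u\<close> Inr by (cases "j = i") auto
      then have "(f y, Inr v) \<in> ?E"
        using y v by (intro E_const) (auto simp: pverts_C5_plus)
      then show False using v by simp
    qed
    then show ?thesis using E[OF x y(1)] y v Inr by auto
  qed
  \<comment> \<open>For \<open>x i\<close> on the cycle, adjacency to all universal vertices puts
    \<open>f x\<close> there too, and neighbourhoods decide. For \<open>x i\<close> universal, a
    different universal value would be adjacent to itself.\<close>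
  have "f x = x i" if x: "x \<in> {..<m} \<rightarrow>\<^sub>E ?V" for x
  proof (cases "x i")
    case (Inl k)
    have k: "k < 5" using PiE_mem[OF x, of i] i Inl by (auto simp: pverts_C5_plus)
    then obtain l where l: "l < 5" "f x = Inl l"
      using C5_plus_in_cycle[OF V[OF x]] nb_all[OF x] Inl by auto
    have "k = l"
      using k l nb_all[OF x, of "Inl _"] Inl by (intro C5_neighbourhood_inject) auto
    then show ?thesis using l Inl by simp
  next
    case (Inr u)
    have u: "u < p" using PiE_mem[OF x, of i] i Inr by (auto simp: pverts_C5_plus)
    obtain v where v: "v < p" "f x = Inr v" using above[OF x Inr] by auto
    then show ?thesis using nb_all[OF x, of "Inr v"] u Inr by auto
  qed
  then show "projection_op (C5_plus p) m f"
    unfolding projection_op_def using i by blast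
qed

theorem theorem4p7:
  fixes p :: nat
  shows "graph_core (C5_plus p) \<and> projective_graph (C5_plus p)"
  using graph_core_C5_plus projective_C5_plus by blast

end
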